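(* Let $f\in\mathbb{Z}[X]$ be a monic irreducible polynomial of degree $n\ge 2$, let $\theta$ be a root of $f$, and let $K=\mathbb{Q}(\theta)$ with ring of integers $\mathcal{O}_K$. Let $p$ be a prime number and $r\in\mathbb{Z}$. Suppose that $p^2\mid f(r)$ and $p\mid f'(r)$. Then $p\mid I(\theta)$; in particular $\mathbb{Z}[\theta]\neq\mathcal{O}_K$.
   Context: $I(\theta)=[\mathcal{O}_K:\mathbb{Z}[\theta]]$ denotes the index of the order $\mathbb{Z}[\theta]$ in $\mathcal{O}_K$. *)

theory Defs
  imports
    "HOL-Algebra.Generated_Fields"
    "HOL-Algebra.Algebraic_Closure_Type"
    "HOL-Computational_Algebra.Computational_Algebra"
begin

text \<open>
  The root \<open>\<theta>\<close> lives in an arbitrary field \<open>'a\<close> of characteristic 0, so that all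
  roots in all extension fields of the rationals are covered; the number field, its ring of
  integers and the order \<open>\<int>[\<theta>]\<close> are subsets of \<open>'a\<close>.
\<close>

text \<open>The field \<open>\<rat>(\<theta>)\<close>. A generated subfield contains 1, hence (characteristic 0) all of
  \<open>\<rat>\<close>, so \<open>{\<theta>}\<close> suffices as generating set.\<close>

definition rat_adjoin :: "'a :: field_char_0 \<Rightarrow> 'a set" where
  "rat_adjoin \<theta> = generate_field ring_of_type_algebra {\<theta>}"

definition ring_of_integers :: "'a :: field_char_0 set \<Rightarrow> 'a set" where
  "ring_of_integers K = {x \<in> K. algebraic_int x}"

definition int_adjoin :: "'a :: field_char_0 \<Rightarrow> 'a set" where
  "int_adjoin \<theta> = range (\<lambda>g :: int poly. poly (map_poly of_int g) \<theta>)"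

text \<open>The index of \<open>\<int>[\<theta>]\<close> in the ring of integers of \<open>\<rat>(\<theta>)\<close>, as additive groups. It is
  finite whenever \<open>\<theta>\<close> is an algebraic integer, the only case of interest, so the convention
  that infinite sets have cardinality 0 plays no role.\<close>

definition order_index :: "'a :: field_char_0 \<Rightarrow> nat" where
  "order_index \<theta> =
     card (a_rcosets\<^bsub>ring_of_type_algebra\<lparr>carrier := ring_of_integers (rat_adjoin \<theta>)\<rparr>\<^esub> (int_adjoin \<theta>))"

end

theory Submission
  imports Defs "Jordan_Normal_Form.Char_Poly"
begin

text \<open>
  Let \<open>q = (f - f(r)) / (X - r)\<close>, which is monic of degree \<open>n - 1\<close>, and \<open>x = q(\<theta>) / p\<close>. The two
  divisibilities make \<open>x\<close> integral over \<open>\<int>[\<theta>]\<close>, while \<open>x \<notin> \<int>[\<theta>]\<close> because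
  \<open>1, \<theta>, \<dots>, \<theta>\<^bsup>n-1\<^esup>\<close> is a basis of \<open>\<int>[\<theta>]\<close> and \<open>p\<close> does not divide the leading coefficient
  of \<open>q\<close>. Hence the class of \<open>x\<close> in \<open>O\<^sub>K / \<int>[\<theta>]\<close> has order \<open>p\<close>.
\<close>

section \<open>Sums and products of algebraic integers\<close>

text \<open>With this structure \<open>int_module.span S\<close> is the additive subgroup generated
  by \<open>S\<close>.\<close>

interpretation int_module: Modules.module "\<lambda>(c :: int) (x :: 'a :: field_char_0). of_int c * x"
  by unfold_locales (simp_all add: algebra_simps)

text \<open>The characteristic polynomial of an integer matrix is monic with integer coefficients,
  and forming it commutes with \<open>of_int\<close>.\<close>

lemma algebraic_int_if_eigenvalue:
  fixes x :: "'a :: field_char_0"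
  assumes M: "M \<in> carrier_mat n n" and ev: "eigenvalue (map_mat of_int M) x"
  shows "algebraic_int x"
proof -
  have "poly (char_poly (map_mat of_int M)) x = 0"
    using eigenvalue_root_char_poly[of "map_mat of_int M" n x] M ev by simp
  then have "poly (map_poly of_int (char_poly M)) x = 0"
    by (simp add: of_int_hom.char_poly_hom[OF M])
  moreover have "lead_coeff (char_poly M) = 1"
    using degree_monic_char_poly[OF M] by simp
  ultimately show ?thesis
    unfolding algebraic_int_altdef_ipoly by blast
qed

text \<open>Multiplication by \<open>x\<close> on the generators \<open>S\<close> is given by an integer matrix, which has
  eigenvalue \<open>x\<close>.\<close>

lemma algebraic_int_if_int_span_stable:
  fixes x :: "'a :: field_char_0"
  assumes fin: "finite S" and "1 \<in> S"
    and stable: "\<And>s. s \<in> S \<Longrightarrow> x * s \<in> int_module.span S"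
  shows "algebraic_int x"
proof -
  have "\<exists>u. x * s = (\<Sum>t\<in>S. of_int (u t) * t)" if "s \<in> S" for s
    using stable[OF that] unfolding int_module.span_finite[OF fin] by blast
  then obtain u where u: "\<And>s. s \<in> S \<Longrightarrow> x * s = (\<Sum>t\<in>S. of_int (u s t) * t)"
    by metis
  obtain h where h: "bij_betw h {0..<card S} S"
    using ex_bij_betw_nat_finite[OF fin] by blast
  define n where "n = card S"
  define M where "M = mat n n (\<lambda>(i, j). u (h i) (h j))"
  define v where "v = vec n h"
  have hS: "h i \<in> S" if "i < n" for i
    using that h by (auto simp: n_def bij_betw_def)
  \<comment> \<open>An eigenvector has to be nonzero; the generator 1 occurs among the entries of
    \<open>v\<close>.\<close>
  have "v \<noteq> 0\<^sub>v n"
  proof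
    assume v0: "v = 0\<^sub>v n"
    from h \<open>1 \<in> S\<close> obtain i where i: "i < n" "h i = 1"
      by (force simp: bij_betw_def n_def)
    then show False
      using arg_cong[OF v0, of "\<lambda>w. vec_index w i"] by (simp add: v_def)
  qed
  moreover have "map_mat of_int M *\<^sub>v v = x \<cdot>\<^sub>v v"
  proof (rule eq_vecI)
    fix i assume "i < dim_vec (x \<cdot>\<^sub>v v)"
    then have i: "i < n" by (simp add: v_def)
    have "(map_mat of_int M *\<^sub>v v) $ i = (\<Sum>j = 0..<n. of_int (u (h i) (h j)) * h j)"
      using i by (simp add: M_def v_def scalar_prod_def)
    also have "\<dots> = (\<Sum>t\<in>S. of_int (u (h i) t) * t)"
      using sum.reindex_bij_betw[OF h, of "\<lambda>t. of_int (u (h i) t) * t"] by (simp add: n_def)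
    also have "\<dots> = (x \<cdot>\<^sub>v v) $ i"
      using u[OF hS[OF i]] i by (simp add: v_def)
    finally show "(map_mat of_int M *\<^sub>v v) $ i = (x \<cdot>\<^sub>v v) $ i" .
  qed (simp add: M_def v_def)
  ultimately have "eigenvalue (map_mat of_int M) x"
    unfolding eigenvalue_def eigenvector_def by (intro exI[of _ v]) (simp add: M_def v_def)
  then show ?thesis
    by (rule algebraic_int_if_eigenvalue[of M n, rotated]) (simp add: M_def)
qed

text \<open>Multiplication by \<open>x\<close> is additive, so its effect on a span is controlled by
  the generators.\<close>

lemma int_span_mult_closed:
  fixes x :: "'a :: field_char_0"
  assumes "\<And>s. s \<in> S \<Longrightarrow> x * s \<in> int_module.span T" and "y \<in> int_module.span S"
  shows "x * y \<in> int_module.span T"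
  using assms(2)
proof (induction rule: int_module.span_induct_alt)
  case base
  then show ?case by (simp add: int_module.span_zero)
next
  case (step c s y)
  have "x * (of_int c * s + y) = of_int c * (x * s) + x * y"
    by (simp add: algebra_simps)
  then show ?case
    using step assms(1) by (auto intro: int_module.span_add int_module.span_scale)
qed

text \<open>A monic integer equation can be solved for its leading power. Positivity of
  \<open>n\<close> puts the exponent 0 in range, so that 1 is among the generators below.\<close>

lemma algebraic_int_power_in_int_span:
  fixes x :: "'a :: field_char_0"
  assumes "algebraic_int x"
  obtains n where "n > 0" and "x ^ n \<in> int_module.span ((\<lambda>i. x ^ i) ` {..<n})"
proof -
  obtain q :: "int poly" where q: "poly (map_poly of_int q) x = 0" "lead_coeff q = 1"
    using assms unfolding algebraic_int_altdef_ipoly by blast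
  let ?n = "degree q" and ?S = "(\<lambda>i. x ^ i) ` {..<degree q}"
  have "?n > 0"
  proof (rule ccontr)
    assume "\<not> ?n > 0"
    then have "q = [:1:]"
      using q(2) by (auto elim: degree_eq_zeroE)
    with q(1) show False by simp
  qed
  have "0 = (\<Sum>i\<le>?n. of_int (coeff q i) * x ^ i)"
    using q(1) by (simp add: poly_altdef)
  also have "\<dots> = (\<Sum>i<?n. of_int (coeff q i) * x ^ i) + x ^ ?n"
    using q(2) by (simp add: lessThan_Suc_atMost[symmetric])
  finally have "x ^ ?n = - (\<Sum>i<?n. of_int (coeff q i) * x ^ i)"
    by (simp add: eq_neg_iff_add_eq_0 add.commute)
  also have "\<dots> \<in> int_module.span ?S"
    by (intro int_module.span_neg int_module.span_sum int_module.span_scale int_module.span_base) simp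
  finally show thesis
    using that \<open>?n > 0\<close> by blast
qed

text \<open>The finitely generated additive group spanned by the products \<open>x\<^sup>i y\<^sup>j\<close> with bounded exponents.\<close>

lemma algebraic_int_pair_stable_set:
  fixes x y :: "'a :: field_char_0"
  assumes "algebraic_int x" and "algebraic_int y"
  obtains S where "finite S" and "1 \<in> S"
    and "\<And>s. s \<in> S \<Longrightarrow> x * s \<in> int_module.span S"
    and "\<And>s. s \<in> S \<Longrightarrow> y * s \<in> int_module.span S"
proof -
  \<comment> \<open>Stated for arbitrary \<open>a\<close> and \<open>b\<close> in order to serve
    both \<open>x\<close> and \<open>y\<close>. Either the raised exponent stays below
    \<open>m\<close>, or \<open>a ^ m\<close> is rewritten by its relation, multiplied by
    \<open>b ^ j\<close>.\<close>
  have shift: "a * (a ^ i * b ^ j) \<in> int_module.span ((\<lambda>(i, j). a ^ i * b ^ j) ` ({..<m} \<times> {..<n}))"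
    if am: "a ^ m \<in> int_module.span ((\<lambda>i. a ^ i) ` {..<m})" and ij: "i < m" "j < n"
    for a b :: 'a and m n i j
  proof (cases "Suc i < m")
    case True
    then show ?thesis
      using ij by (intro int_module.span_base image_eqI[of _ _ "(Suc i, j)"]) (auto simp: mult.assoc)
  next
    case False
    with ij have m: "m = Suc i" by simp
    have "b ^ j * a ^ m \<in> int_module.span ((\<lambda>(i, j). a ^ i * b ^ j) ` ({..<m} \<times> {..<n}))"
      by (rule int_span_mult_closed[OF _ am])
        (use ij in \<open>force intro!: int_module.span_base simp: mult.commute\<close>)
    then show ?thesis by (simp add: m mult_ac)
  qed
  obtain m where m: "m > 0" "x ^ m \<in> int_module.span ((\<lambda>i. x ^ i) ` {..<m})"
    using algebraic_int_power_in_int_span[OF assms(1)] .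
  obtain n where n: "n > 0" "y ^ n \<in> int_module.span ((\<lambda>i. y ^ i) ` {..<n})"
    using algebraic_int_power_in_int_span[OF assms(2)] .
  let ?S = "(\<lambda>(i, j). x ^ i * y ^ j) ` ({..<m} \<times> {..<n})"
  have swap: "(\<lambda>(i, j). y ^ i * x ^ j) ` ({..<n} \<times> {..<m}) = ?S"
    by (force simp: mult.commute)
  show thesis
  proof
    show "finite ?S" by simp
    show "1 \<in> ?S"
      using m(1) n(1) by (intro image_eqI[of _ _ "(0, 0)"]) auto
    show "x * s \<in> int_module.span ?S" if "s \<in> ?S" for s
      using that shift[OF m(2)] by auto
    show "y * s \<in> int_module.span ?S" if "s \<in> ?S" for s
    proof -
      from that obtain i j where "i < m" "j < n" "s = y ^ j * x ^ i"
        by (auto simp: mult.commute)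
      with shift[OF n(2), of j i m x] show ?thesis
        by (simp add: swap)
    qed
  qed
qed

lemma algebraic_int_add:
  fixes x y :: "'a :: field_char_0"
  assumes "algebraic_int x" and "algebraic_int y"
  shows "algebraic_int (x + y)"
proof -
  obtain S where S: "finite S" "1 \<in> S"
    "\<And>s. s \<in> S \<Longrightarrow> x * s \<in> int_module.span S" "\<And>s. s \<in> S \<Longrightarrow> y * s \<in> int_module.span S"
    using algebraic_int_pair_stable_set[OF assms] by blast
  show ?thesis
    by (rule algebraic_int_if_int_span_stable[OF S(1,2)])
      (use S(3,4) in \<open>auto simp: distrib_right intro: int_module.span_add\<close>)
qed

lemma algebraic_int_mult:
  fixes x y :: "'a :: field_char_0"
  assumes "algebraic_int x" and "algebraic_int y"
  shows "algebraic_int (x * y)"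
proof -
  obtain S where S: "finite S" "1 \<in> S"
    "\<And>s. s \<in> S \<Longrightarrow> x * s \<in> int_module.span S" "\<And>s. s \<in> S \<Longrightarrow> y * s \<in> int_module.span S"
    using algebraic_int_pair_stable_set[OF assms] by blast
  show ?thesis
    by (rule algebraic_int_if_int_span_stable[OF S(1,2)])
      \<comment> \<open>Multiplication by \<open>y\<close> sends \<open>S\<close> into its span, and
        multiplication by \<open>x\<close> maps that span to itself.\<close>
      (auto simp: mult.assoc intro: int_span_mult_closed[OF S(3) S(4)])
qed

lemma algebraic_int_poly:
  fixes x :: "'a :: field_char_0"
  assumes "algebraic_int x"
  shows "algebraic_int (poly (map_poly of_int g) x)"
  by (induction g) (auto simp: of_int_hom.map_poly_pCons_hom intro!: algebraic_int_add algebraic_int_mult assms)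

section \<open>The order and the ring of integers\<close>

lemma rat_adjoin_generator: "\<theta> \<in> rat_adjoin \<theta>"
  unfolding rat_adjoin_def by (rule generate_field.incl) simp

lemma rat_adjoin_1: "1 \<in> rat_adjoin \<theta>"
  using generate_field.one[of ring_of_type_algebra]
  unfolding rat_adjoin_def by (simp add: ring_of_type_algebra_def)

lemma rat_adjoin_add: "x \<in> rat_adjoin \<theta> \<Longrightarrow> y \<in> rat_adjoin \<theta> \<Longrightarrow> x + y \<in> rat_adjoin \<theta>"
  using generate_field.eng_add[of x ring_of_type_algebra]
  unfolding rat_adjoin_def by (simp add: ring_of_type_algebra_def)

lemma rat_adjoin_mult: "x \<in> rat_adjoin \<theta> \<Longrightarrow> y \<in> rat_adjoin \<theta> \<Longrightarrow> x * y \<in> rat_adjoin \<theta>"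
  using generate_field.eng_mult[of x ring_of_type_algebra]
  unfolding rat_adjoin_def by (simp add: ring_of_type_algebra_def)

lemma rat_adjoin_minus:
  fixes x :: "'a :: field_char_0"
  assumes "x \<in> rat_adjoin \<theta>"
  shows "- x \<in> rat_adjoin \<theta>"
proof -
  interpret R: Ring.field "ring_of_type_algebra :: 'a ring" by (rule field_from_type_algebra)
  \<comment> \<open>\<open>generate_field\<close> is closed under the negation of the ring record,
    which has to be identified with that of the type class.\<close>
  have "\<ominus>\<^bsub>ring_of_type_algebra\<^esub> x = - x"
    by (rule R.minus_equality) (simp_all add: ring_of_type_algebra_def)
  then show ?thesis
    using generate_field.a_inv[of x ring_of_type_algebra] assms
    unfolding rat_adjoin_def by simp
qed

lemma rat_adjoin_inverse:
  fixes x :: "'a :: field_char_0"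
  assumes "x \<in> rat_adjoin \<theta>" and "x \<noteq> 0"
  shows "inverse x \<in> rat_adjoin \<theta>"
proof -
  interpret R: Ring.field "ring_of_type_algebra :: 'a ring" by (rule field_from_type_algebra)
  have "inv\<^bsub>ring_of_type_algebra\<^esub> x = inverse x"
    by (rule R.comm_inv_char) (use assms(2) in \<open>simp_all add: ring_of_type_algebra_def\<close>)
  moreover have "\<zero>\<^bsub>ring_of_type_algebra\<^esub> = (0 :: 'a)"
    by (simp add: ring_of_type_algebra_def)
  ultimately show ?thesis
    using generate_field.m_inv[of x ring_of_type_algebra] assms
    unfolding rat_adjoin_def by simp
qed

lemma rat_adjoin_0: "0 \<in> rat_adjoin \<theta>"
  using rat_adjoin_add[OF rat_adjoin_1 rat_adjoin_minus[OF rat_adjoin_1]] by simp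

lemma rat_adjoin_of_int: "of_int k \<in> rat_adjoin \<theta>"
  by (induction k rule: int_induct[of _ 0])
    (auto intro: rat_adjoin_add rat_adjoin_1 rat_adjoin_0 rat_adjoin_minus
      simp: diff_conv_add_uminus simp del: add_uminus_conv_diff)

lemma rat_adjoin_poly: "poly (map_poly of_int g) \<theta> \<in> rat_adjoin \<theta>"
  by (induction g)
    (auto simp: of_int_hom.map_poly_pCons_hom
      intro!: rat_adjoin_add rat_adjoin_mult rat_adjoin_generator rat_adjoin_of_int rat_adjoin_0)

section \<open>The additive groups \<int>[\<theta>] and O_K\<close>

lemma int_adjoin_subset_ring_of_integers:
  assumes "algebraic_int \<theta>"
  shows "int_adjoin \<theta> \<subseteq> ring_of_integers (rat_adjoin \<theta>)"
  using assms by (auto simp: int_adjoin_def ring_of_integers_def rat_adjoin_poly algebraic_int_poly)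

lemma ring_of_integers_add:
  "x \<in> ring_of_integers (rat_adjoin \<theta>) \<Longrightarrow> y \<in> ring_of_integers (rat_adjoin \<theta>) \<Longrightarrow>
    x + y \<in> ring_of_integers (rat_adjoin \<theta>)"
  by (simp add: ring_of_integers_def rat_adjoin_add algebraic_int_add)

lemma ring_of_integers_minus:
  "x \<in> ring_of_integers (rat_adjoin \<theta>) \<Longrightarrow> - x \<in> ring_of_integers (rat_adjoin \<theta>)"
  by (simp add: ring_of_integers_def rat_adjoin_minus)

lemma ring_of_integers_0: "0 \<in> ring_of_integers (rat_adjoin \<theta>)"
  by (simp add: ring_of_integers_def rat_adjoin_0)

lemma int_adjoin_add: "x \<in> int_adjoin \<theta> \<Longrightarrow> y \<in> int_adjoin \<theta> \<Longrightarrow> x + y \<in> int_adjoin \<theta>"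
  unfolding int_adjoin_def
  by (auto simp: image_iff) (metis of_int_hom.map_poly_hom_add poly_add)

lemma int_adjoin_minus: "x \<in> int_adjoin \<theta> \<Longrightarrow> - x \<in> int_adjoin \<theta>"
  unfolding int_adjoin_def
  by (auto simp: image_iff) (metis of_int_poly_hom.hom_uminus poly_minus)

lemma int_adjoin_0: "0 \<in> int_adjoin \<theta>"
  unfolding int_adjoin_def by (auto simp: image_iff intro!: exI[of _ 0])

section \<open>Prime divisors of the index from elements of the quotient\<close>

text \<open>If the index is infinite, \<open>card\<close> is 0 and the claim is trivial.\<close>

lemma (in group) prime_dvd_card_rcosets:
  fixes p :: nat
  assumes "H \<lhd> G" and "Factorial_Ring.prime p"
    and x: "x \<in> carrier G" "x \<notin> H" "x [^] p \<in> H"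
  shows "p dvd card (rcosets H)"
proof -
  interpret N: normal H G by fact
  interpret Q: group "G Mod H" by (rule N.factorgroup_is_group)
  interpret h: group_hom G "G Mod H" "\<lambda>a. H #> a"
    by unfold_locales (rule N.r_coset_hom_Mod)
  let ?y = "H #> x"
  have y: "?y \<in> carrier (G Mod H)"
    using x(1) by simp
  have "?y [^]\<^bsub>G Mod H\<^esub> p = H #> (x [^] p)"
    using x(1) by (simp add: h.hom_nat_pow)
  also have "\<dots> = \<one>\<^bsub>G Mod H\<^esub>"
    using x(3) N.rcos_const by simp
  finally have "Q.ord ?y dvd p"
    using Q.pow_eq_id[OF y] by simp
  moreover have "Q.ord ?y \<noteq> 1"
  proof
    assume "Q.ord ?y = 1"
    then have "?y = \<one>\<^bsub>G Mod H\<^esub>"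
      using Q.ord_eq_1[OF y] by simp
    then have "?y = H"
      by simp
    then show False
      using x(2) coset_join1[OF _ x(1) N.subgroup_axioms] by blast
  qed
  ultimately have "Q.ord ?y = p"
    using \<open>Factorial_Ring.prime p\<close> by (auto simp: prime_nat_iff)
  \<comment> \<open>Lagrange in the quotient group, whose order is the number of cosets.\<close>
  then show ?thesis
    using Q.ord_dvd_group_order[OF y] by (simp add: Coset.order_def FactGroup_def)
qed

text \<open>The group statement is applied to O_K / \<int>[\<theta>]. Integrality of
  \<open>\<theta>\<close> puts \<int>[\<theta>] inside O_K, and commutativity makes it
  normal.\<close>

lemma prime_dvd_order_index:
  fixes \<theta> :: "'a :: field_char_0"
  assumes \<theta>: "algebraic_int \<theta>" and p: "Factorial_Ring.prime (p :: nat)"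
    and x: "x \<in> ring_of_integers (rat_adjoin \<theta>)" "x \<notin> int_adjoin \<theta>"
    and px: "of_nat p * x \<in> int_adjoin \<theta>"
  shows "p dvd order_index \<theta>"
proof -
  let ?R = "ring_of_type_algebra\<lparr>carrier := ring_of_integers (rat_adjoin \<theta>)\<rparr>"
  let ?G = "add_monoid ?R"
  have G: "comm_group ?G"
  proof (rule comm_groupI)
    fix a assume "a \<in> carrier ?G"
    then show "\<exists>b\<in>carrier ?G. b \<otimes>\<^bsub>?G\<^esub> a = \<one>\<^bsub>?G\<^esub>"
      using ring_of_integers_minus
      by (intro bexI[of _ "- a"]) (auto simp: ring_of_type_algebra_def)
  qed (auto simp: ring_of_type_algebra_def ring_of_integers_add ring_of_integers_0 algebra_simps)
  interpret G: comm_group ?G by (rule G)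
  have inv: "inv\<^bsub>?G\<^esub> a = - a" if "a \<in> ring_of_integers (rat_adjoin \<theta>)" for a
    using that ring_of_integers_minus[OF that]
    by (intro G.inv_equality) (auto simp: ring_of_type_algebra_def)
  have sub: "int_adjoin \<theta> \<subseteq> ring_of_integers (rat_adjoin \<theta>)"
    by (rule int_adjoin_subset_ring_of_integers[OF \<theta>])
  have "subgroup (int_adjoin \<theta>) ?G"
  proof (rule G.subgroupI)
    show "int_adjoin \<theta> \<noteq> {}" using int_adjoin_0 by blast
  next
    fix a assume "a \<in> int_adjoin \<theta>"
    then show "inv\<^bsub>?G\<^esub> a \<in> int_adjoin \<theta>"
      using sub inv[of a] int_adjoin_minus[of a] by (metis subsetD)
  qed (use sub in \<open>auto simp: ring_of_type_algebra_def int_adjoin_add\<close>)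
  then have N: "int_adjoin \<theta> \<lhd> ?G"
    by (rule G.subgroup_imp_normal)
  \<comment> \<open>Powers in the additive group are multiples, so the hypothesis \<open>px\<close>
    becomes the power condition on \<open>x\<close>.\<close>
  have pow: "x [^]\<^bsub>?G\<^esub> n = of_nat n * x" for n :: nat
    by (induction n) (simp_all add: ring_of_type_algebra_def algebra_simps)
  show ?thesis
    unfolding order_index_def A_RCOSETS_def
    by (rule G.prime_dvd_card_rcosets[OF N p, of x]) (use x px pow in simp_all)
qed

section \<open>An algebraic integer outside the order\<close>

text \<open>An integer polynomial \<open>m\<close> of least degree among the nonzero ones vanishing
  at \<open>\<theta>\<close> divides a nonzero constant multiple of \<open>f\<close>. As
  \<open>f\<close> is prime in \<int>[X], it divides \<open>m\<close> or the cofactor; in the second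
  case \<open>m\<close> would divide a nonzero constant.\<close>

lemma degree_ge_if_common_root:
  fixes f u :: "int poly" and \<theta> :: "'a :: field_char_0"
  assumes f: "Factorial_Ring.irreducible f" "poly (map_poly of_int f) \<theta> = 0"
    and u: "u \<noteq> 0" "poly (map_poly of_int u) \<theta> = 0"
  shows "degree f \<le> degree u"
proof -
  define P where "P = (\<lambda>m :: int poly. m \<noteq> 0 \<and> poly (map_poly of_int m) \<theta> = 0)"
  obtain m where m: "P m" and least: "\<And>v. P v \<Longrightarrow> degree m \<le> degree v"
    using ex_has_least_nat[of P u degree] u by (auto simp: P_def)
  have m0: "m \<noteq> 0" "poly (map_poly of_int m) \<theta> = 0"
    using m by (auto simp: P_def)
  obtain c q where c: "c \<noteq> 0" and cf: "smult c f = m * q + pseudo_mod f m"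
    using pseudo_mod(1)[OF m0(1)] by blast
  have "poly (map_poly of_int (pseudo_mod f m)) \<theta> = 0"
    using arg_cong[OF cf, of "\<lambda>h. poly (map_poly of_int h) \<theta>"] f(2) m0(2)
    by (simp add: of_int_poly_hom.hom_add of_int_poly_hom.hom_mult of_int_hom.map_poly_hom_smult)
  \<comment> \<open>A nonzero pseudo-remainder would vanish at \<open>\<theta>\<close> and have
    smaller degree than \<open>m\<close>.\<close>
  then have "pseudo_mod f m = 0"
    using least[of "pseudo_mod f m"] pseudo_mod(2)[OF m0(1), of f] by (fastforce simp: P_def)
  with cf have eq: "smult c f = m * q" by simp
  then have "f dvd m * q"
    by (metis dvd_smult dvd_refl)
  then consider "f dvd m" | "f dvd q"
    using irreducible_imp_prime_elem[OF f(1)] prime_elem_dvd_mult_iff by blast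
  then have "degree f \<le> degree m"
  proof cases
    case 1
    then show ?thesis using m0(1) dvd_imp_degree_le by blast
  next
    case 2
    then obtain q' where q': "q = f * q'" by blast
    have "f \<noteq> 0" using f(1) by auto
    have "f * [:c:] = f * (m * q')"
      using eq q' by (simp add: mult_ac)
    then have mq: "m * q' = [:c:]"
      using \<open>f \<noteq> 0\<close> by (metis mult_cancel_left)
    have "poly (map_poly of_int [:c:]) \<theta> = 0"
      unfolding mq[symmetric] using m0(2) by (simp add: of_int_poly_hom.hom_mult)
    then show ?thesis using c by simp
  qed
  with least[of u] u show ?thesis by (simp add: P_def)
qed

lemma int_adjoin_repr_degree_less:
  fixes f :: "int poly" and \<theta> :: "'a :: field_char_0"
  assumes f: "lead_coeff f = 1" "poly (map_poly of_int f) \<theta> = 0" and x: "x \<in> int_adjoin \<theta>"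
  obtains h where "h = 0 \<or> degree h < degree f" and "x = poly (map_poly of_int h) \<theta>"
proof -
  obtain g where g: "x = poly (map_poly of_int g) \<theta>"
    using x by (auto simp: int_adjoin_def)
  obtain q h where qh: "pseudo_divmod g f = (q, h)" by fastforce
  have "f \<noteq> 0" using f(1) by auto
  \<comment> \<open>Since \<open>f\<close> is monic, the scaling factor of the pseudo-division is
    1.\<close>
  from pseudo_divmod[OF this qh] f(1) have "g = f * q + h" "h = 0 \<or> degree h < degree f"
    by simp_all
  then show thesis
    using f(2) g that by (simp add: of_int_poly_hom.hom_add of_int_poly_hom.hom_mult)
qed

text \<open>Polynomials of degree below \<open>degree f\<close> are determined by their value at
  \<open>\<theta>\<close>, so \<open>q\<close> equals \<open>k\<close> times the reduced
  representative of \<open>x\<close>.\<close>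

lemma int_adjoin_scaled_lead_coeff:
  fixes f q :: "int poly" and \<theta> :: "'a :: field_char_0"
  assumes f: "lead_coeff f = 1" "Factorial_Ring.irreducible f" "poly (map_poly of_int f) \<theta> = 0"
    and q: "degree q < degree f"
    and x: "x \<in> int_adjoin \<theta>" "of_int k * x = poly (map_poly of_int q) \<theta>"
  shows "k dvd lead_coeff q"
proof -
  obtain h where h: "h = 0 \<or> degree h < degree f" "x = poly (map_poly of_int h) \<theta>"
    using int_adjoin_repr_degree_less[OF f(1,3) x(1)] .
  have "degree (smult k h - q) < degree f"
    using h(1) q by (intro degree_diff_less) auto
  moreover have "poly (map_poly of_int (smult k h - q)) \<theta> = 0"
    using h(2) x(2) by (simp add: of_int_poly_hom.hom_minus of_int_hom.map_poly_hom_smult)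
  ultimately have "smult k h - q = 0"
    using degree_ge_if_common_root[OF f(2,3), of "smult k h - q"] by linarith
  then have "q = smult k h" by simp
  then show ?thesis by simp
qed

section \<open>Synthetic division at \<open>r\<close> and integrality of the quotient\<close>

lemma synthetic_div_monic:
  fixes f :: "'b :: comm_ring_1 poly"
  assumes "lead_coeff f = 1" and "degree f > 0"
  shows "lead_coeff (synthetic_div f r) = 1"
proof -
  obtain m where m: "degree f = Suc m"
    using assms(2) by (auto simp: gr0_conv_Suc)
  have deg: "degree (synthetic_div f r) = m"
    by (simp add: degree_synthetic_div m)
  \<comment> \<open>The summand \<open>smult r (synthetic_div f r)\<close> has degree at most
    \<open>m\<close>, so on the left only the leading coefficient of \<open>f\<close>
    survives.\<close>
  have "coeff (f + smult r (synthetic_div f r)) (Suc m) =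
      coeff (pCons (poly f r) (synthetic_div f r)) (Suc m)"
    by (simp only: synthetic_div_correct)
  then show ?thesis
    using assms(1) m deg by (simp add: coeff_eq_0)
qed

text \<open>Differentiate f = (X - r) q + f(r) and evaluate at \<open>r\<close>: the term containing
  q' vanishes.\<close>

lemma poly_synthetic_div_eq_pderiv:
  fixes f :: "'b :: idom poly"
  shows "poly (synthetic_div f r) r = poly (pderiv f) r"
  using arg_cong[OF synthetic_div_correct'[of r f], of "\<lambda>h. poly (pderiv h) r"]
  by (simp add: pderiv_add pderiv_diff pderiv_smult pderiv_pCons)

text \<open>Write \<open>f = (X - r) q + f(r)\<close> and \<open>q = (X - r) g + f'(r)\<close>, so \<open>q(r) = f'(r)\<close>. With
  \<open>f(r) = p\<^sup>2 b\<close> and \<open>f'(r) = p a\<close>, evaluating at \<open>\<theta>\<close> shows that \<open>x = q(\<theta>) / p\<close> satisfies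
  \<open>x\<^sup>2 - a x = - b g(\<theta>)\<close>.\<close>

lemma algebraic_int_synthetic_div:
  fixes f :: "int poly" and \<theta> :: "'a :: field_char_0"
  assumes \<theta>: "algebraic_int \<theta>" "poly (map_poly of_int f) \<theta> = 0" and "k \<noteq> 0"
    and dvd: "k\<^sup>2 dvd poly f r" "k dvd poly (pderiv f) r"
  shows "algebraic_int (poly (map_poly of_int (synthetic_div f r)) \<theta> / of_int k)"
proof -
  define q where "q = synthetic_div f r"
  define g where "g = synthetic_div q r"
  define ev where "ev = (\<lambda>h :: int poly. poly (map_poly of_int h) \<theta>)"
  define x where "x = ev q / of_int k"
  obtain b where b: "poly f r = k\<^sup>2 * b" using dvd(1) by blast
  obtain a where a: "poly q r = k * a"
    using dvd(2) unfolding q_def poly_synthetic_div_eq_pderiv by blast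
  have ev_decomp: "ev h = (\<theta> - of_int r) * ev (synthetic_div h r) + of_int (poly h r)" for h
    using arg_cong[OF synthetic_div_correct'[of r h], of ev]
    by (simp add: ev_def of_int_poly_hom.hom_add of_int_poly_hom.hom_minus
        of_int_hom.map_poly_hom_smult of_int_hom.map_poly_pCons_hom algebra_simps)
  have evf: "(\<theta> - of_int r) * ev q = - of_int (k\<^sup>2 * b)"
    using ev_decomp[of f] \<theta>(2) b by (simp add: q_def ev_def eq_neg_iff_add_eq_0)
  define c where "c = \<theta> - of_int r"
  have evq: "ev q = c * ev g + of_int k * of_int a"
    using ev_decomp[of q] a by (simp add: g_def c_def)
  have cq: "c * ev q = - (of_int k * of_int k * of_int b)"
    using evf by (simp add: c_def power2_eq_square)
  \<comment> \<open>One factor \<open>ev q - of_int k * of_int a\<close> is \<open>c * ev g\<close>;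
    its \<open>c\<close> joins the other \<open>ev q\<close> to give the known product
    \<open>cq\<close>, which supplies the factor \<open>k\<^sup>2\<close> to cancel.\<close>
  have "ev q * ev q - of_int k * of_int a * ev q = (ev q - of_int k * of_int a) * ev q"
    by (simp only: left_diff_distrib)
  also have "\<dots> = ev g * (c * ev q)"
    using evq by (simp only: add_diff_cancel_right' mult_ac)
  finally have "ev q * ev q - of_int k * of_int a * ev q = - (of_int k * of_int k * of_int b * ev g)"
    by (simp only: cq mult_minus_right mult_ac)
  moreover have "ev q = of_int k * x"
    using \<open>k \<noteq> 0\<close> by (simp add: x_def)
  ultimately have "(of_int k * of_int k) * (x\<^sup>2 - of_int a * x) =
      (of_int k * of_int k) * (- of_int b * ev g)"
    by (simp only: power2_eq_square right_diff_distrib mult_minus_left mult_minus_right mult_ac)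
  then have "x\<^sup>2 - of_int a * x = - of_int b * ev g"
    using \<open>k \<noteq> 0\<close> by (simp only: mult_cancel_left) simp
  then have root: "poly [:0, - of_int a, 1:] x = - of_int b * ev g"
    by (simp add: power2_eq_square algebra_simps)
  \<comment> \<open>A monic integer polynomial takes an algebraic integer as value at
    \<open>x\<close>, hence \<open>x\<close> itself is an algebraic integer.\<close>
  have "algebraic_int (- of_int b * ev g)"
    unfolding ev_def using \<theta>(1) by (intro algebraic_int_mult algebraic_int_poly) auto
  moreover note root
  moreover have "\<forall>i. coeff [:0, - of_int a, 1:] i \<in> (\<int> :: 'a set)"
    by (auto simp: coeff_pCons split: nat.splits)
  ultimately have "algebraic_int x"
    by (rule algebraic_int_root) simp_all
  then show ?thesis
    by (simp add: x_def ev_def q_def)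
qed

theorem theorem3p2:
  fixes f :: "int poly" and \<theta> :: "'a :: field_char_0" and p :: nat and r :: int
  assumes "lead_coeff f = 1" and "Factorial_Ring.irreducible f" and "Polynomial.degree f \<ge> 2"
    and "poly (map_poly of_int f) \<theta> = 0"
    and "Factorial_Ring.prime p"
    and "(int p)\<^sup>2 dvd poly f r" and "int p dvd poly (pderiv f) r"
  shows "p dvd order_index \<theta> \<and> int_adjoin \<theta> \<noteq> ring_of_integers (rat_adjoin \<theta>)"
proof -
  have \<theta>: "algebraic_int \<theta>"
    unfolding algebraic_int_altdef_ipoly using assms(1,4) by blast
  have p: "p > 1" using assms(5) by (rule prime_gt_1_nat)
  let ?q = "synthetic_div f r"
  define x where "x = poly (map_poly of_int ?q) \<theta> / of_int (int p)"
  have px: "of_int (int p) * x = poly (map_poly of_int ?q) \<theta>"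
    using p by (simp add: x_def)
  have "algebraic_int x"
    unfolding x_def using assms(4,6,7) p \<theta> by (intro algebraic_int_synthetic_div) auto
  moreover have "x \<in> rat_adjoin \<theta>"
    unfolding x_def divide_inverse using p
    by (intro rat_adjoin_mult rat_adjoin_poly rat_adjoin_inverse rat_adjoin_of_int) simp
  ultimately have x: "x \<in> ring_of_integers (rat_adjoin \<theta>)"
    by (simp add: ring_of_integers_def)
  have x_notin: "x \<notin> int_adjoin \<theta>"
  proof
    assume "x \<in> int_adjoin \<theta>"
    \<comment> \<open>The quotient has degree \<open>degree f - 1\<close>, as the lemma requires,
      and its leading coefficient is 1, which \<open>p\<close> cannot divide.\<close>
    then have "int p dvd lead_coeff ?q"
      using assms(3) px
      by (intro int_adjoin_scaled_lead_coeff[OF assms(1,2,4)]) (simp_all add: degree_synthetic_div)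
    then show False
      using synthetic_div_monic[OF assms(1)] assms(3) p by simp
  qed
  have "of_nat p * x \<in> int_adjoin \<theta>"
    using px by (auto simp: int_adjoin_def)
  then have "p dvd order_index \<theta>"
    by (rule prime_dvd_order_index[OF \<theta> assms(5) x x_notin])
  with x x_notin show ?thesis by blast
qed

end
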